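(* Let $\Omega\subset\mathbb{R}^n$ be open, let $f\in C([0,\infty))$ be non-decreasing, and let $M,N>0$ and $\gamma\in[0,3)$ be such that $$0\le f(\delta t)\le M\delta^\gamma f(t)\quad\text{and}\quad f(\delta t)\ge N\delta^\gamma f(t)\ge 0\qquad\text{for bounded } t>0 \text{ and all sufficiently small } \delta>0 .$$ If $u$ is a non-negative viscosity solution of $\Delta_\infty u=f(u)$ in $\Omega$, then the free boundary $\partial\{u>0\}\cap\Omega$ has Lebesgue measure zero.
   Context: The infinity Laplacian is $\Delta_\infty u:=\sum_{i,j=1}^n u_{x_i}u_{x_j}u_{x_ix_j}$. Viscosity solutions: a function $u\in C(\Omega)$ (with values in $[0,\infty)$, where $f$ is defined) is a viscosity super-solution of $\Delta_\infty u=f(u)$ in $\Omega$ if for every $\phi\in C^2(\Omega)$ such that $u-\phi$ has a local minimum at $x_0\in\Omega$ with $\phi(x_0)=u(x_0)$, one has $\Delta_\infty\phi(x_0)\le f(\phi(x_0))$. It is a viscosity sub-solution if for every $\phi\in C^2(\Omega)$ such that $u-\phi$ has a local maximum at $x_0\in\Omega$ with $\phi(x_0)=u(x_0)$, one has $\Delta_\infty\phi(x_0)\ge f(\phi(x_0))$. It is a viscosity solution if it is both. The growth conditions "for bounded $t>0$ and all sufficiently small $\delta>0$" mean: for every $T>0$ there is $\delta_0>0$ such that the inequalities hold for all $0<t\le T$ and $0<\delta<\delta_0$. Here $\{u>0\}=\{x\in\Omega:u(x)>0\}$. *)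

theory Defs
  imports "HOL-Analysis.Analysis"
begin

definition partial_deriv :: "'n::finite \<Rightarrow> (real ^ 'n \<Rightarrow> real) \<Rightarrow> real ^ 'n \<Rightarrow> real" where
  "partial_deriv i \<phi> x = deriv (\<lambda>t. \<phi> (x + t *\<^sub>R axis i 1)) 0"

text \<open>The classical spaces on an open set: all partial derivatives up to the given order exist
  and are continuous.  Existence has to be required separately because \<^const>\<open>deriv\<close> is total.\<close>

definition C1_on :: "(real ^ 'n::finite) set \<Rightarrow> (real ^ 'n \<Rightarrow> real) \<Rightarrow> bool" where
  "C1_on \<Omega> \<phi> \<longleftrightarrow>
     continuous_on \<Omega> \<phi> \<and>
     (\<forall>i. (\<forall>x\<in>\<Omega>. (\<lambda>t. \<phi> (x + t *\<^sub>R axis i 1)) field_differentiable (at 0)) \<and>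
          continuous_on \<Omega> (partial_deriv i \<phi>))"

definition C2_on :: "(real ^ 'n::finite) set \<Rightarrow> (real ^ 'n \<Rightarrow> real) \<Rightarrow> bool" where
  "C2_on \<Omega> \<phi> \<longleftrightarrow> C1_on \<Omega> \<phi> \<and> (\<forall>i. C1_on \<Omega> (partial_deriv i \<phi>))"

definition inf_laplacian :: "(real ^ 'n::finite \<Rightarrow> real) \<Rightarrow> real ^ 'n \<Rightarrow> real" where
  "inf_laplacian \<phi> x =
     (\<Sum>i\<in>UNIV. \<Sum>j\<in>UNIV.
        partial_deriv i \<phi> x * partial_deriv j \<phi> x * partial_deriv j (partial_deriv i \<phi>) x)"

text \<open>Viscosity solutions of \<open>\<Delta>\<^sub>\<infinity> u = f(u)\<close> in \<open>\<Omega>\<close>.  The nonlinearity \<open>f\<close> is only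
  meaningful on \<open>[0,\<infinity>)\<close>, so the definitions are intended for functions \<open>u\<close> that are
  non-negative on \<open>\<Omega>\<close>.\<close>

definition viscosity_supersol ::
    "(real \<Rightarrow> real) \<Rightarrow> (real ^ 'n::finite) set \<Rightarrow> (real ^ 'n \<Rightarrow> real) \<Rightarrow> bool" where
  "viscosity_supersol f \<Omega> u \<longleftrightarrow>
     continuous_on \<Omega> u \<and>
     (\<forall>\<phi> x0. C2_on \<Omega> \<phi> \<longrightarrow> x0 \<in> \<Omega> \<longrightarrow> \<phi> x0 = u x0 \<longrightarrow>
        (\<forall>\<^sub>F x in at x0 within \<Omega>. u x0 - \<phi> x0 \<le> u x - \<phi> x) \<longrightarrow>
        inf_laplacian \<phi> x0 \<le> f (\<phi> x0))"

definition viscosity_subsol ::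
    "(real \<Rightarrow> real) \<Rightarrow> (real ^ 'n::finite) set \<Rightarrow> (real ^ 'n \<Rightarrow> real) \<Rightarrow> bool" where
  "viscosity_subsol f \<Omega> u \<longleftrightarrow>
     continuous_on \<Omega> u \<and>
     (\<forall>\<phi> x0. C2_on \<Omega> \<phi> \<longrightarrow> x0 \<in> \<Omega> \<longrightarrow> \<phi> x0 = u x0 \<longrightarrow>
        (\<forall>\<^sub>F x in at x0 within \<Omega>. u x - \<phi> x \<le> u x0 - \<phi> x0) \<longrightarrow>
        inf_laplacian \<phi> x0 \<ge> f (\<phi> x0))"

definition viscosity_sol ::
    "(real \<Rightarrow> real) \<Rightarrow> (real ^ 'n::finite) set \<Rightarrow> (real ^ 'n \<Rightarrow> real) \<Rightarrow> bool" where
  "viscosity_sol f \<Omega> u \<longleftrightarrow> viscosity_supersol f \<Omega> u \<and> viscosity_subsol f \<Omega> u"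

end

theory Submission
  imports Defs
begin

text \<open>
  Put \<open>\<beta> = 4 / (3 - \<gamma>)\<close>, so that \<open>\<rho>\<^sup>\<beta>\<close> balances \<open>\<Delta>\<^sub>\<infinity>\<close> against \<open>t\<^sup>\<gamma>\<close>; near \<open>0\<close> the
  hypotheses make \<open>f(t)\<close> comparable to \<open>f(1) t\<^sup>\<gamma>\<close>.  If \<open>u z = 0\<close> and \<open>u y > A |z - y|\<^sup>\<beta>\<close> with \<open>A\<close>
  large, then for some \<open>R > |z - y|\<close> the function \<open>A (R - |x - y|)\<^sup>\<beta>\<close> lies below \<open>u\<close> at the puncture
  \<open>y\<close> and on the sphere of radius \<open>R\<close>, and is a strict subsolution in between; comparison gives
  \<open>u z > 0\<close>.  Hence \<open>u \<le> A dist\<^sup>\<beta>\<close> from each zero.  In the other direction comparison with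
  \<open>c (\<epsilon> + |x - x1|\<^sup>2)\<^bsup>\<beta>/2\<^esup>\<close> shows that \<open>u\<close> reaches \<open>c r\<^sup>\<beta>\<close> in each ball of radius \<open>r\<close> about a
  positivity point \<open>x1\<close>.  When \<open>f(1) > 0\<close>, the two rates make the free boundary porous, hence null
  by Vitali's covering theorem.  When \<open>f(1) = 0\<close>, the growth bound holds for every \<open>A > 0\<close>, so the
  zero set is open and the free boundary is empty.
\<close>

subsection \<open>Porous sets\<close>

text \<open>Enclose \<open>S\<close> in an open \<open>T\<close> with \<open>T - S\<close> of
  measure below \<open>q * e\<close>, where \<open>q\<close> is the volume ratio of a hole to its
  ball. Vitali's theorem covers \<open>S\<close> up to a null set by disjoint balls inside
  \<open>T\<close>, each with a hole lying in \<open>T - S\<close>. The holes are disjoint as well,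
  so the balls have total measure at most \<open>e\<close>.\<close>

lemma porous_imp_negligible:
  fixes S :: "'a::euclidean_space set"
  assumes S: "S \<in> sets lebesgue" and "0 < \<kappa>"
    and porous: "\<And>x e. x \<in> S \<Longrightarrow> 0 < e \<Longrightarrow>
      \<exists>r y. 0 < r \<and> r < e \<and> ball y (\<kappa> * r) \<subseteq> ball x r \<and> ball y (\<kappa> * r) \<inter> S = {}"
  shows "negligible S"
  unfolding negligible_outer_le
proof (intro allI impI)
  fix e :: real assume "e > 0"
  let ?\<mu> = "measure lebesgue"
  let ?B = "\<lambda>p::'a \<times> real. ball (fst p) (snd p)"
  define q where "q = \<kappa> ^ DIM('a)"
  have q: "q > 0" using \<open>0 < \<kappa>\<close> by (simp add: q_def)
  obtain T where T: "open T" "S \<subseteq> T" "T - S \<in> lmeasurable" "emeasure lebesgue (T - S) < ennreal (q * e)"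
    using sets_lebesgue_outer_open[OF S, of "q * e"] q \<open>e > 0\<close> by auto
  have small: "?\<mu> (T - S) \<le> q * e"
    using T(3,4) q \<open>e > 0\<close> by (simp add: emeasure_eq_measure2 ennreal_less_iff)
  define K where "K = {(x,r). 0 < r \<and> ball x r \<subseteq> T \<and>
    (\<exists>y. ball y (\<kappa> * r) \<subseteq> ball x r \<and> ball y (\<kappa> * r) \<inter> S = {})}"
  obtain C where "countable C" and CK: "C \<subseteq> K"
    and pw: "pairwise (\<lambda>i j. disjnt (?B i) (?B j)) C"
    and neg: "negligible (S - (\<Union>i\<in>C. ?B i))"
  proof (rule Vitali_covering_theorem_balls [of S K fst snd])
    fix x d assume x: "x \<in> S" and "(0::real) < d"
    obtain k where k: "k > 0" "ball x k \<subseteq> T"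
      using T x by (meson openE subsetD)
    obtain r y where r: "0 < r" "r < min d k" "ball y (\<kappa> * r) \<subseteq> ball x r" "ball y (\<kappa> * r) \<inter> S = {}"
      using porous[OF x, of "min d k"] \<open>0 < d\<close> k by auto
    have "ball x r \<subseteq> T"
      using r k by (meson min_less_iff_conj less_imp_le order_trans subset_ball)
    with r show "\<exists>i. i \<in> K \<and> x \<in> ?B i \<and> snd i < d"
      by (intro exI[of _ "(x,r)"]) (auto simp: K_def)
  qed
  have "\<exists>y. ball y (\<kappa> * snd p) \<subseteq> ?B p \<and> ball y (\<kappa> * snd p) \<inter> S = {}" if "p \<in> C" for p
    using that CK unfolding K_def by fastforce
  then obtain Y where Y: "\<And>p. p \<in> C \<Longrightarrow> ball (Y p) (\<kappa> * snd p) \<subseteq> ?B p"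
    "\<And>p. p \<in> C \<Longrightarrow> ball (Y p) (\<kappa> * snd p) \<inter> S = {}"
    by metis
  have CT: "\<And>p. p \<in> C \<Longrightarrow> ?B p \<subseteq> T \<and> 0 < snd p" using CK unfolding K_def by fastforce
  have le: "?\<mu> (\<Union>i\<in>I. ?B i) \<le> e" if I: "I \<subseteq> C" "finite I" for I
  proof -
    have "q * ?\<mu> (\<Union>i\<in>I. ?B i) \<le> q * (\<Sum>i\<in>I. ?\<mu> (?B i))"
      using q I by (intro mult_left_mono measure_UNION_le) auto
    also have "\<dots> = (\<Sum>i\<in>I. ?\<mu> (ball (Y i) (\<kappa> * snd i)))"
      unfolding sum_distrib_left
    proof (rule sum.cong)
      fix p assume "p \<in> I"
      then have "0 < snd p" using CT I by blast
      then show "q * ?\<mu> (?B p) = ?\<mu> (ball (Y p) (\<kappa> * snd p))"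
        using \<open>0 < \<kappa>\<close> content_ball_conv_unit_ball[of "snd p" "fst p"]
          content_ball_conv_unit_ball[of "\<kappa> * snd p" "Y p"]
        by (simp add: q_def power_mult_distrib)
    qed simp
    also have "\<dots> = ?\<mu> (\<Union>i\<in>I. ball (Y i) (\<kappa> * snd i))"
    proof (rule measure_UNION'[symmetric])
      show "pairwise (\<lambda>i j. disjnt (ball (Y i) (\<kappa> * snd i)) (ball (Y j) (\<kappa> * snd j))) I"
        using pairwise_subset[OF pw I(1)] Y(1) I(1)
        unfolding pairwise_def by (meson disjnt_subset1 disjnt_subset2 subsetD)
    qed (use I in auto)
    also have "\<dots> \<le> ?\<mu> (T - S)"
    proof (rule measure_mono_fmeasurable)
      show "(\<Union>i\<in>I. ball (Y i) (\<kappa> * snd i)) \<subseteq> T - S"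
        using Y CT I by fastforce
    qed (use T I in \<open>auto intro!: sets.finite_UN\<close>)
    also have "\<dots> \<le> q * e" by (rule small)
    finally show ?thesis using q by simp
  qed
  \<comment> \<open>The bound for finite subfamilies passes to the countable union. The null part of
    \<open>S\<close> that the balls miss is then added back to form \<open>?T\<close>.\<close>
  have U: "(\<Union>i\<in>C. ?B i) \<in> lmeasurable" "?\<mu> (\<Union>i\<in>C. ?B i) \<le> e"
    using \<open>e > 0\<close> le by (auto intro!: fmeasurable_UN_bound [OF \<open>countable C\<close>] measure_UN_bound [OF \<open>countable C\<close>])
  let ?T = "(S - (\<Union>i\<in>C. ?B i)) \<union> (\<Union>i\<in>C. ?B i)"
  have "?\<mu> ?T = ?\<mu> (\<Union>i\<in>C. ?B i)"
    by (rule measure_negligible_symdiff[OF U(1)]) (force intro!: negligible_subset [OF neg])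
  moreover have "?T \<in> lmeasurable"
    by (rule fmeasurable.Un[OF negligible_imp_measurable[OF neg] U(1)])
  moreover have "S \<subseteq> ?T" by blast
  ultimately show "\<exists>T. S \<subseteq> T \<and> T \<in> lmeasurable \<and> ?\<mu> T \<le> e"
    using U(2) by (intro exI[of _ ?T] conjI) (assumption, assumption, simp only:)
qed

subsection \<open>Radial test functions\<close>

text \<open>The gap \<open>D\<close> between the quadratic and \<open>g\<close> has derivative
  \<open>k\<close>, and \<open>k\<close> vanishes at \<open>s0\<close> with slope
  \<open>c - b > 0\<close>. So \<open>k\<close> has the sign of \<open>s - s0\<close> near
  \<open>s0\<close>, and the mean value theorem makes \<open>D\<close> non-negative on both sides. A
  second derivative at the single point \<open>s0\<close> is enough for this.\<close>

lemma second_order_upper_bound: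
  fixes g g' :: "real \<Rightarrow> real"
  assumes g: "\<forall>\<^sub>F s in nhds s0. (g has_real_derivative g' s) (at s)"
    and g': "(g' has_real_derivative b) (at s0)" and "b < c"
  shows "\<forall>\<^sub>F s in nhds s0. g s \<le> g s0 + g' s0 * (s - s0) + c / 2 * (s - s0)\<^sup>2"
proof -
  define k where "k = (\<lambda>s. g' s0 + c * (s - s0) - g' s)"
  define D where "D = (\<lambda>s. g s0 + g' s0 * (s - s0) + c / 2 * (s - s0)\<^sup>2 - g s)"
  have k: "(k has_real_derivative c - b) (at s0)"
    unfolding k_def by (auto intro!: derivative_eq_intros g')
  obtain d1 where d1: "d1 > 0" "\<And>h. 0 < h \<Longrightarrow> h < d1 \<Longrightarrow> k s0 < k (s0 + h)"
    using DERIV_pos_inc_right[OF k] \<open>b < c\<close> by auto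
  obtain d2 where d2: "d2 > 0" "\<And>h. 0 < h \<Longrightarrow> h < d2 \<Longrightarrow> k (s0 - h) < k s0"
    using DERIV_pos_inc_left[OF k] \<open>b < c\<close> by auto
  obtain d3 where d3: "d3 > 0" "\<And>s. dist s s0 < d3 \<Longrightarrow> (g has_real_derivative g' s) (at s)"
    using g unfolding eventually_nhds_metric by auto
  define d where "d = min d1 (min d2 d3)"
  have D: "(D has_real_derivative k s) (at s)" if "dist s s0 < d" for s
    unfolding D_def k_def using d3(2)[of s] that
    by (auto intro!: derivative_eq_intros simp: d_def)
  have k0: "k s0 = 0" and D0: "D s0 = 0" by (auto simp: k_def D_def)
  have "0 \<le> D s" if s: "dist s s0 < d" for s
  proof (cases s s0 rule: linorder_cases)
    case less
    then obtain z where z: "s < z" "z < s0" "D s0 - D s = (s0 - s) * k z"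
      using MVT2[of s s0 D k] D s by (auto simp: dist_real_def)
    have "k z < 0" using d2(2)[of "s0 - z"] z s k0 by (auto simp: d_def dist_real_def)
    then show ?thesis using z less D0 by (simp add: mult_less_0_iff less_imp_le[of 0 "D s"] flip: neg_less_0_iff_less)
  next
    case equal then show ?thesis using D0 by simp
  next
    case greater
    then obtain z where z: "s0 < z" "z < s" "D s - D s0 = (s - s0) * k z"
      using MVT2[of s0 s D k] D s by (auto simp: dist_real_def)
    have "k z > 0" using d1(2)[of "z - s0"] z s k0 by (auto simp: d_def dist_real_def)
    then show ?thesis using z greater D0 by simp
  qed
  then show ?thesis
    unfolding eventually_nhds_metric D_def using d1(1) d2(1) d3(1)
    by (intro exI[of _ d]) (auto simp: d_def)
qed

text \<open>The squared distance is the radial variable because along an axis it is a quadratic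
  polynomial in \<open>t\<close>, hence smooth even at the centre \<open>y\<close>.\<close>

lemma has_real_derivative_along_axis:
  fixes x y :: "real ^ 'n::finite"
  assumes "(h has_real_derivative h') (at ((norm (x - y))\<^sup>2))"
  shows "((\<lambda>t. h ((norm (x + t *\<^sub>R axis i 1 - y))\<^sup>2)) has_real_derivative h' * (2 * (x - y) $ i)) (at 0)"
proof -
  have e: "(norm (x + t *\<^sub>R axis i 1 - y))\<^sup>2 = (norm (x - y))\<^sup>2 + 2 * t * (x - y) $ i + t\<^sup>2" for t
  proof -
    have "x + t *\<^sub>R axis i 1 - y = (x - y) + t *\<^sub>R axis i 1" by simp
    then show ?thesis
      by (simp only: power2_norm_eq_inner inner_add_left inner_add_right)
        (simp add: inner_axis inner_axis' power2_eq_square)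
  qed
  have "((\<lambda>t. (norm (x - y))\<^sup>2 + 2 * t * (x - y) $ i + t\<^sup>2) has_real_derivative 2 * (x - y) $ i) (at 0)"
    by (auto intro!: derivative_eq_intros)
  then show ?thesis unfolding e
    by (rule DERIV_chain2[rotated]) (use assms in simp)
qed

section \<open>Derivatives and infinity Laplacian of functions of the squared distance\<close>

context
  fixes h h' h'' :: "real \<Rightarrow> real" and y :: "real ^ 'n::finite"
  assumes h: "\<And>s. (h has_real_derivative h' s) (at s)"
    and h': "\<And>s. (h' has_real_derivative h'' s) (at s)"
    and h'': "continuous_on UNIV h''"
begin

lemma partial_deriv_radial:
  "partial_deriv i (\<lambda>x. h ((norm (x - y))\<^sup>2)) = (\<lambda>x. h' ((norm (x - y))\<^sup>2) * (2 * (x - y) $ i))"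
  unfolding partial_deriv_def by (intro ext DERIV_imp_deriv has_real_derivative_along_axis h)

lemma has_real_derivative_radial2:
  "((\<lambda>t. h' ((norm (x + t *\<^sub>R axis j 1 - y))\<^sup>2) * (2 * (x + t *\<^sub>R axis j 1 - y) $ i))
     has_real_derivative
       h'' ((norm (x - y))\<^sup>2) * (2 * (x - y) $ j) * (2 * (x - y) $ i) + h' ((norm (x - y))\<^sup>2) * (2 * of_bool (i = j))) (at 0)"
proof -
  have "((\<lambda>t. 2 * (x + t *\<^sub>R axis j 1 - y) $ i) has_real_derivative 2 * of_bool (i = j)) (at 0)"
    by (auto intro!: derivative_eq_intros simp: axis_def)
  from DERIV_mult[OF has_real_derivative_along_axis[OF h', of x j y] this]
  show ?thesis by (simp only: mult_ac add_ac add_0_right add_0_left mult_zero_left scaleR_zero_left)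
qed

lemma partial_deriv_radial2:
  "partial_deriv j (partial_deriv i (\<lambda>x. h ((norm (x - y))\<^sup>2))) =
    (\<lambda>x. h'' ((norm (x - y))\<^sup>2) * (2 * (x - y) $ j) * (2 * (x - y) $ i) + h' ((norm (x - y))\<^sup>2) * (2 * of_bool (i = j)))"
  unfolding partial_deriv_radial
  by (rule ext, unfold partial_deriv_def, rule DERIV_imp_deriv, rule has_real_derivative_radial2)

lemma C2_on_radial: "C2_on \<Omega> (\<lambda>x. h ((norm (x - y))\<^sup>2))"
proof -
  have ch: "continuous_on UNIV h" and ch': "continuous_on UNIV h'"
    using h h' by (meson DERIV_isCont continuous_at_imp_continuous_on)+
  note c = continuous_on_compose2[OF ch] continuous_on_compose2[OF ch'] continuous_on_compose2[OF h'']
  have "continuous_on \<Omega> (\<lambda>x. (norm (x - y))\<^sup>2)"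
    by (intro continuous_intros)
  then have "continuous_on \<Omega> (\<lambda>x. h ((norm (x - y))\<^sup>2))" "continuous_on \<Omega> (\<lambda>x. h' ((norm (x - y))\<^sup>2))"
    "continuous_on \<Omega> (\<lambda>x. h'' ((norm (x - y))\<^sup>2))"
    using c by auto
  note [continuous_intros] = this
  show ?thesis
    unfolding C2_on_def C1_on_def partial_deriv_radial2
    unfolding partial_deriv_radial field_differentiable_def
    by (intro conjI allI ballI exI) (rule has_real_derivative_along_axis[OF h] has_real_derivative_radial2 |
      intro continuous_intros)+
qed

text \<open>With \<open>v = x - y\<close> and \<open>s\<close> its squared norm, the gradient is
  \<open>2 h' v\<close> and the Hessian is \<open>4 h''\<close> times the rank-one matrix of
  \<open>v\<close> plus \<open>2 h'\<close> times the identity. The rank-one part and the diagonal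
  part of the double sum are evaluated separately.\<close>

lemma inf_laplacian_radial:
  "inf_laplacian (\<lambda>x. h ((norm (x - y))\<^sup>2)) x =
    8 * (norm (x - y))\<^sup>2 * (h' ((norm (x - y))\<^sup>2))\<^sup>2 * (2 * (norm (x - y))\<^sup>2 * h'' ((norm (x - y))\<^sup>2) + h' ((norm (x - y))\<^sup>2))"
proof -
  define s where "s = (norm (x - y))\<^sup>2"
  define v where "v = x - y"
  have s: "s = (\<Sum>i\<in>UNIV. v $ i * v $ i)"
    by (simp add: s_def v_def power2_norm_eq_inner inner_vec_def)
  have "inf_laplacian (\<lambda>x. h ((norm (x - y))\<^sup>2)) x =
    (\<Sum>i\<in>UNIV. \<Sum>j\<in>UNIV. 16 * (h' s)\<^sup>2 * h'' s * (v $ i * v $ i) * (v $ j * v $ j)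
       + (if i = j then 8 * (h' s)^3 * (v $ i * v $ i) else 0))"
    unfolding inf_laplacian_def partial_deriv_radial2 unfolding partial_deriv_radial s_def[symmetric]
    unfolding v_def[symmetric]
  proof (intro sum.cong refl)
    fix i j :: 'n
    show "h' s * (2 * v $ i) * (h' s * (2 * v $ j)) *
        (h'' s * (2 * v $ j) * (2 * v $ i) + h' s * (2 * of_bool (i = j))) =
      16 * (h' s)\<^sup>2 * h'' s * (v $ i * v $ i) * (v $ j * v $ j)
       + (if i = j then 8 * (h' s)^3 * (v $ i * v $ i) else 0)"
      by (cases "i = j") (simp_all add: algebra_simps power2_eq_square power3_eq_cube)
  qed
  also have "\<dots> = 16 * (h' s)\<^sup>2 * h'' s * s * s + 8 * (h' s)^3 * s"
    by (simp only: sum.distrib sum.delta sum.delta' finite UNIV_I if_True sum_distrib_left[symmetric] sum_distrib_right[symmetric] s[symmetric])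
  finally show ?thesis unfolding s_def[symmetric]
    by (simp add: algebra_simps power2_eq_square power3_eq_cube)
qed

end

text \<open>This performs the limit \<open>e\<close> to 0, both for perturbed test functions and for
  the growth constant \<open>A\<close> in the case \<open>f 1 = 0\<close>.\<close>

lemma le_affine_imp_le:
  fixes a b k :: real
  assumes "0 \<le> k" and "\<And>e. 0 < e \<Longrightarrow> a \<le> b + k * e"
  shows "a \<le> b"
proof (rule field_le_epsilon)
  fix e :: real assume "0 < e"
  then have "a \<le> b + k * (e / (k + 1))" using assms by (intro assms) auto
  also have "\<dots> \<le> b + e" using \<open>0 < e\<close> \<open>0 \<le> k\<close> by (simp add: field_simps)
  finally show "a \<le> b + e" .
qed

section \<open>Viscosity inequalities tested with radial profiles\<close>

lemma filterlim_norm_diff_power2: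
  fixes x0 y :: "'a::real_normed_vector"
  shows "filterlim (\<lambda>x. (norm (x - y))\<^sup>2) (nhds ((norm (x0 - y))\<^sup>2)) (at x0 within \<Omega>)"
  by (intro tendsto_intros)

lemma viscosity_subsolD:
  assumes "viscosity_subsol f \<Omega> u" "C2_on \<Omega> \<phi>" "x0 \<in> \<Omega>" "\<phi> x0 = u x0"
    and "\<forall>\<^sub>F x in at x0 within \<Omega>. u x - \<phi> x \<le> u x0 - \<phi> x0"
  shows "f (u x0) \<le> inf_laplacian \<phi> x0"
  using assms(1)[unfolded viscosity_subsol_def, THEN conjunct2, rule_format, OF assms(2-5)] assms(4) by simp

lemma viscosity_supersolD:
  assumes "viscosity_supersol f \<Omega> u" "C2_on \<Omega> \<phi>" "x0 \<in> \<Omega>" "\<phi> x0 = u x0"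
    and "\<forall>\<^sub>F x in at x0 within \<Omega>. u x0 - \<phi> x0 \<le> u x - \<phi> x"
  shows "inf_laplacian \<phi> x0 \<le> f (u x0)"
  using assms(1)[unfolded viscosity_supersol_def, THEN conjunct2, rule_format, OF assms(2-5)] assms(4) by simp

text \<open>The profile \<open>g\<close> is controlled only near \<open>s0\<close>, so it need not
  give a test function that is C2 on all of \<Omega>. It is replaced by a quadratic in
  \<open>s\<close> with the same slope and the slightly larger second derivative
  \<open>b + e\<close>. This lies above \<open>g\<close> up to a constant, so the local maximum
  survives; then \<open>e\<close> tends to 0.\<close>

lemma viscosity_subsol_radial:
  fixes x0 y :: "real ^ 'n::finite"
  defines "s0 \<equiv> (norm (x0 - y))\<^sup>2"
  assumes sub: "viscosity_subsol f \<Omega> u" and "x0 \<in> \<Omega>"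
    and g: "\<forall>\<^sub>F s in nhds s0. (g has_real_derivative g' s) (at s)"
    and g': "(g' has_real_derivative b) (at s0)"
    and max: "\<forall>\<^sub>F x in at x0 within \<Omega>. u x - g ((norm (x - y))\<^sup>2) \<le> u x0 - g s0"
  shows "f (u x0) \<le> 8 * s0 * (g' s0)\<^sup>2 * (2 * s0 * b + g' s0)"
proof (rule le_affine_imp_le)
  show "0 \<le> 16 * s0\<^sup>2 * (g' s0)\<^sup>2" by simp
  fix e :: real assume "0 < e"
  \<comment> \<open>The constant term is \<open>u x0\<close> and not \<open>g s0\<close>, since a
    test function has to agree with \<open>u\<close> at \<open>x0\<close>.\<close>
  define h where "h = (\<lambda>s. u x0 + g' s0 * (s - s0) + (b + e) / 2 * (s - s0)\<^sup>2)"
  define h' where "h' = (\<lambda>s. g' s0 + (b + e) * (s - s0))"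
  have h: "(h has_real_derivative h' s) (at s)" "(h' has_real_derivative b + e) (at s)" for s
    unfolding h_def h'_def by (auto intro!: derivative_eq_intros)
  have "\<forall>\<^sub>F s in nhds s0. g s \<le> g s0 + g' s0 * (s - s0) + (b + e) / 2 * (s - s0)\<^sup>2"
    using second_order_upper_bound[OF g g'] \<open>0 < e\<close> by simp
  then have "\<forall>\<^sub>F s in nhds s0. g s - g s0 \<le> h s - u x0"
    by eventually_elim (simp add: h_def)
  from eventually_compose_filterlim[OF this[unfolded s0_def] filterlim_norm_diff_power2, of \<Omega>]
  have "\<forall>\<^sub>F x in at x0 within \<Omega>. g ((norm (x - y))\<^sup>2) - g s0 \<le> h ((norm (x - y))\<^sup>2) - u x0"
    unfolding s0_def .
  with max have "\<forall>\<^sub>F x in at x0 within \<Omega>. u x - h ((norm (x - y))\<^sup>2) \<le> u x0 - h ((norm (x0 - y))\<^sup>2)"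
    by eventually_elim (simp add: h_def s0_def)
  moreover have "h ((norm (x0 - y))\<^sup>2) = u x0" by (simp add: h_def s0_def)
  moreover have "C2_on \<Omega> (\<lambda>x. h ((norm (x - y))\<^sup>2))"
    by (rule C2_on_radial[OF h]) simp
  ultimately have "f (u x0) \<le> inf_laplacian (\<lambda>x. h ((norm (x - y))\<^sup>2)) x0"
    using \<open>x0 \<in> \<Omega>\<close> by (intro viscosity_subsolD[OF sub])
  also have "\<dots> = 8 * s0 * (h' s0)\<^sup>2 * (2 * s0 * (b + e) + h' s0)"
    unfolding s0_def by (rule inf_laplacian_radial[OF h]) simp
  also have "\<dots> = 8 * s0 * (g' s0)\<^sup>2 * (2 * s0 * b + g' s0) + 16 * s0\<^sup>2 * (g' s0)\<^sup>2 * e"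
    by (simp add: h'_def algebra_simps power2_eq_square)
  finally show "f (u x0) \<le> \<dots>" .
qed

text \<open>The mirror image: the quadratic bound is applied to \<open>- g\<close>, which gives a
  quadratic with second derivative \<open>b - e\<close> below \<open>g\<close> up to a
  constant.\<close>

lemma viscosity_supersol_radial:
  fixes x0 y :: "real ^ 'n::finite"
  defines "s0 \<equiv> (norm (x0 - y))\<^sup>2"
  assumes sup: "viscosity_supersol f \<Omega> u" and "x0 \<in> \<Omega>"
    and g: "\<forall>\<^sub>F s in nhds s0. (g has_real_derivative g' s) (at s)"
    and g': "(g' has_real_derivative b) (at s0)"
    and min: "\<forall>\<^sub>F x in at x0 within \<Omega>. u x0 - g s0 \<le> u x - g ((norm (x - y))\<^sup>2)"
  shows "8 * s0 * (g' s0)\<^sup>2 * (2 * s0 * b + g' s0) \<le> f (u x0)"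
proof (rule le_affine_imp_le)
  show "0 \<le> 16 * s0\<^sup>2 * (g' s0)\<^sup>2" by simp
  fix e :: real assume "0 < e"
  define h where "h = (\<lambda>s. u x0 + g' s0 * (s - s0) + (b - e) / 2 * (s - s0)\<^sup>2)"
  define h' where "h' = (\<lambda>s. g' s0 + (b - e) * (s - s0))"
  have h: "(h has_real_derivative h' s) (at s)" "(h' has_real_derivative b - e) (at s)" for s
    unfolding h_def h'_def by (auto intro!: derivative_eq_intros)
  have "\<forall>\<^sub>F s in nhds s0. ((\<lambda>s. - g s) has_real_derivative - g' s) (at s)"
    using g by eventually_elim (rule DERIV_minus)
  from second_order_upper_bound[OF this DERIV_minus[OF g'], of "- (b - e)"] \<open>0 < e\<close>
  have "\<forall>\<^sub>F s in nhds s0. g s \<ge> g s0 + g' s0 * (s - s0) + (b - e) / 2 * (s - s0)\<^sup>2"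
    by (auto elim!: eventually_mono simp: field_simps)
  then have "\<forall>\<^sub>F s in nhds s0. g s - g s0 \<ge> h s - u x0"
    by eventually_elim (simp add: h_def)
  from eventually_compose_filterlim[OF this[unfolded s0_def] filterlim_norm_diff_power2, of \<Omega>]
  have "\<forall>\<^sub>F x in at x0 within \<Omega>. g ((norm (x - y))\<^sup>2) - g s0 \<ge> h ((norm (x - y))\<^sup>2) - u x0"
    unfolding s0_def .
  with min have "\<forall>\<^sub>F x in at x0 within \<Omega>. u x0 - h ((norm (x0 - y))\<^sup>2) \<le> u x - h ((norm (x - y))\<^sup>2)"
    by eventually_elim (simp add: h_def s0_def)
  moreover have "h ((norm (x0 - y))\<^sup>2) = u x0" by (simp add: h_def s0_def)
  moreover have "C2_on \<Omega> (\<lambda>x. h ((norm (x - y))\<^sup>2))"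
    by (rule C2_on_radial[OF h]) simp
  ultimately have *: "inf_laplacian (\<lambda>x. h ((norm (x - y))\<^sup>2)) x0 \<le> f (u x0)"
    using \<open>x0 \<in> \<Omega>\<close> by (intro viscosity_supersolD[OF sup])
  have "inf_laplacian (\<lambda>x. h ((norm (x - y))\<^sup>2)) x0 = 8 * s0 * (h' s0)\<^sup>2 * (2 * s0 * (b - e) + h' s0)"
    unfolding s0_def by (rule inf_laplacian_radial[OF h]) simp
  also have "\<dots> = 8 * s0 * (g' s0)\<^sup>2 * (2 * s0 * b + g' s0) - 16 * s0\<^sup>2 * (g' s0)\<^sup>2 * e"
    by (simp add: h'_def algebra_simps power2_eq_square)
  finally show "8 * s0 * (g' s0)\<^sup>2 * (2 * s0 * b + g' s0) \<le> f (u x0) + 16 * s0\<^sup>2 * (g' s0)\<^sup>2 * e"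
    using * by simp
qed

text \<open>For a profile in the distance itself the infinity Laplacian is \<open>G'\<close> squared
  times \<open>G''\<close>. The substitution is \<open>g s = G (sqrt s)\<close>, which is
  differentiable away from the centre; hence \<open>x0 \<noteq> y\<close>.\<close>

lemma viscosity_supersol_radial_dist:
  fixes x0 y :: "real ^ 'n::finite"
  defines "\<rho>0 \<equiv> norm (x0 - y)"
  assumes sup: "viscosity_supersol f \<Omega> u" and "x0 \<in> \<Omega>" and "x0 \<noteq> y"
    and G: "\<forall>\<^sub>F \<rho> in nhds \<rho>0. (G has_real_derivative G' \<rho>) (at \<rho>)"
    and G': "(G' has_real_derivative b) (at \<rho>0)"
    and min: "\<forall>\<^sub>F x in at x0 within \<Omega>. u x0 - G \<rho>0 \<le> u x - G (norm (x - y))"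
  shows "(G' \<rho>0)\<^sup>2 * b \<le> f (u x0)"
proof -
  have \<rho>0: "\<rho>0 > 0" using \<open>x0 \<noteq> y\<close> by (simp add: \<rho>0_def)
  define g' where "g' = (\<lambda>s. G' (sqrt s) / (2 * sqrt s))"
  have "filterlim sqrt (nhds \<rho>0) (nhds (\<rho>0\<^sup>2))"
    using tendsto_real_sqrt[OF filterlim_ident, of "\<rho>0\<^sup>2"] \<rho>0 by simp
  then have "\<forall>\<^sub>F s in nhds (\<rho>0\<^sup>2). (G has_real_derivative G' (sqrt s)) (at (sqrt s))"
    by (rule eventually_compose_filterlim[OF G])
  moreover have "\<forall>\<^sub>F s in nhds (\<rho>0\<^sup>2). s > 0"
    using \<rho>0 by (intro eventually_nhds_in_open[of "{0<..}", simplified]) auto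
  ultimately have 1: "\<forall>\<^sub>F s in nhds (\<rho>0\<^sup>2). ((\<lambda>s. G (sqrt s)) has_real_derivative g' s) (at s)"
  proof eventually_elim
    case (elim s)
    from DERIV_chain2[OF elim(1) DERIV_real_sqrt[OF elim(2)]] show ?case
      by (simp add: g'_def field_simps)
  qed
  have sqrt: "(sqrt has_real_derivative 1 / (2 * \<rho>0)) (at (\<rho>0\<^sup>2))"
    using DERIV_real_sqrt[of "\<rho>0\<^sup>2"] \<rho>0 by (simp add: field_simps)
  have "((\<lambda>s. G' (sqrt s)) has_real_derivative b * (1 / (2 * \<rho>0))) (at (\<rho>0\<^sup>2))"
    by (rule DERIV_chain2[OF _ sqrt]) (use \<rho>0 G' in simp)
  from DERIV_divide[OF this DERIV_cmult[OF sqrt, of 2]]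
  have 2: "(g' has_real_derivative (b - G' \<rho>0 / \<rho>0) / (2 * \<rho>0)\<^sup>2) (at (\<rho>0\<^sup>2))"
    using \<rho>0 unfolding g'_def by (simp add: power2_eq_square)
  have "8 * \<rho>0\<^sup>2 * (g' (\<rho>0\<^sup>2))\<^sup>2 * (2 * \<rho>0\<^sup>2 * ((b - G' \<rho>0 / \<rho>0) / (2 * \<rho>0)\<^sup>2) + g' (\<rho>0\<^sup>2)) \<le> f (u x0)"
    unfolding \<rho>0_def
    by (rule viscosity_supersol_radial[OF sup \<open>x0 \<in> \<Omega>\<close> 1[unfolded \<rho>0_def] 2[unfolded \<rho>0_def]])
      (use min in \<open>simp add: \<rho>0_def\<close>)
  also have "2 * \<rho>0\<^sup>2 * ((b - G' \<rho>0 / \<rho>0) / (2 * \<rho>0)\<^sup>2) + g' (\<rho>0\<^sup>2) = b / 2"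
    using \<rho>0 by (simp add: g'_def power2_eq_square field_simps)
  also have "8 * \<rho>0\<^sup>2 * (g' (\<rho>0\<^sup>2))\<^sup>2 = 2 * (G' \<rho>0)\<^sup>2"
    using \<rho>0 by (simp add: g'_def power2_eq_square)
  finally show ?thesis by simp
qed

subsection \<open>Growth and non-degeneracy at the free boundary\<close>

text \<open>By the condition on \<open>K\<close>, the barrier is a strict subsolution away from the
  centre and the sphere. If it exceeded \<open>u\<close> somewhere, \<open>u\<close> minus the
  barrier would have a negative minimum at some \<open>p\<close>. The centre is excluded by the
  bound on \<open>u y\<close>, the sphere because the barrier vanishes there, and any other
  \<open>p\<close> by the supersolution inequality and monotonicity of \<open>f\<close>.\<close>

lemma viscosity_supersol_barrier:
  fixes y :: "real ^ 'n::finite"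
  assumes sup: "viscosity_supersol f \<Omega> u" and mono: "mono_on {0..} f"
    and nonneg: "\<And>x. x \<in> \<Omega> \<Longrightarrow> 0 \<le> u x" and sub: "cball y R \<subseteq> \<Omega>"
    and "0 < A" "0 \<le> \<gamma>" "\<gamma> < 3" and \<beta>: "\<beta> = 4 / (3 - \<gamma>)"
    and f: "\<And>t. 0 < t \<Longrightarrow> t \<le> u y \<Longrightarrow> f t \<le> K * t powr \<gamma>"
    and K: "K * A powr \<gamma> < A^3 * \<beta>^3 * (\<beta> - 1)"
    and uy: "A * R powr \<beta> \<le> u y" and x: "x \<in> cball y R"
  shows "A * (R - norm (x - y)) powr \<beta> \<le> u x"
proof (rule ccontr)
  define w where "w = (\<lambda>x. A * (R - norm (x - y)) powr \<beta>)"
  \<comment> \<open>This identity determines \<beta>: it gives the infinity Laplacian of the barrier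
    and the \<gamma>-th power of the barrier the same power of \<open>D\<close>.\<close>
  have \<beta>1: "\<beta> > 1" and \<beta>\<gamma>: "3 * \<beta> - 4 = \<beta> * \<gamma>"
    using \<open>0 \<le> \<gamma>\<close> \<open>\<gamma> < 3\<close> by (auto simp: \<beta> field_simps)
  assume "\<not> ?thesis"
  then have ux: "u x < w x" by (simp add: w_def)
  have "continuous_on (cball y R) w"
    unfolding w_def using \<beta>1
    by (intro continuous_intros continuous_on_powr') (auto simp: dist_norm norm_minus_commute)
  moreover have "continuous_on (cball y R) u"
    using sup sub unfolding viscosity_supersol_def by (meson continuous_on_subset)
  ultimately obtain p where p: "p \<in> cball y R"
    and min: "\<And>x. x \<in> cball y R \<Longrightarrow> u p - w p \<le> u x - w x"
    using continuous_attains_inf[OF compact_cball _ continuous_on_diff, of y R u w] x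
    by blast
  have up: "u p < w p" using min[OF x] ux by linarith
  have "0 \<le> u p" using p sub nonneg by auto
  have "p \<noteq> y" using up uy by (auto simp: w_def)
  have "norm (p - y) \<noteq> R" using up \<open>0 \<le> u p\<close> by (auto simp: w_def)
  then have pR: "norm (p - y) < R" using p by (simp add: dist_norm norm_minus_commute)
  define D where "D = R - norm (p - y)"
  have D: "0 < D" using pR by (simp add: D_def)
  have "((- (A * \<beta> * D powr (\<beta> - 1)))\<^sup>2 * (A * \<beta> * (\<beta> - 1) * D powr (\<beta> - 2))) \<le> f (u p)"
    unfolding D_def
  proof (rule viscosity_supersol_radial_dist[OF sup, where G = "\<lambda>\<rho>. A * (R - \<rho>) powr \<beta>"
      and G' = "\<lambda>\<rho>. - (A * \<beta> * (R - \<rho>) powr (\<beta> - 1))"])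
    show "p \<in> \<Omega>" using p sub by auto
    show "p \<noteq> y" by fact
    have "\<forall>\<^sub>F \<rho> in nhds (norm (p - y)). \<rho> < R"
      using pR by (intro eventually_nhds_in_open[of "{..<R}", simplified]) auto
    then show "\<forall>\<^sub>F \<rho> in nhds (norm (p - y)). ((\<lambda>\<rho>. A * (R - \<rho>) powr \<beta>) has_real_derivative
        - (A * \<beta> * (R - \<rho>) powr (\<beta> - 1))) (at \<rho>)"
      by eventually_elim (auto intro!: derivative_eq_intros)
    show "((\<lambda>\<rho>. - (A * \<beta> * (R - \<rho>) powr (\<beta> - 1))) has_real_derivative
        A * \<beta> * (\<beta> - 1) * (R - norm (p - y)) powr (\<beta> - 2)) (at (norm (p - y)))"
      using pR by (auto intro!: derivative_eq_intros)
    have "\<forall>\<^sub>F x in at p within \<Omega>. x \<in> ball y R"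
      using pR unfolding eventually_at_topological
      by (intro exI[of _ "ball y R"]) (auto simp: dist_norm norm_minus_commute)
    then show "\<forall>\<^sub>F x in at p within \<Omega>. u p - A * (R - norm (p - y)) powr \<beta>
        \<le> u x - A * (R - norm (x - y)) powr \<beta>"
      by eventually_elim (use min in \<open>auto simp: w_def\<close>)
  qed
  also have "f (u p) \<le> f (w p)"
    using mono up \<open>0 \<le> u p\<close> by (auto simp: mono_on_def)
  also have "f (w p) \<le> K * w p powr \<gamma>"
  proof (rule f)
    show "0 < w p" using up \<open>0 \<le> u p\<close> by simp
    \<comment> \<open>The barrier is largest at its centre, so its values stay in the range where
      the bound on \<open>f\<close> is assumed.\<close>
    have "w p \<le> A * R powr \<beta>"
      unfolding w_def using \<open>0 < A\<close> \<beta>1 pR by (intro mult_left_mono powr_mono2) auto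
    then show "w p \<le> u y" using uy by simp
  qed
  also have "\<dots> = K * A powr \<gamma> * D powr (\<beta> * \<gamma>)"
    using \<open>0 < A\<close> by (simp add: w_def D_def powr_mult powr_powr)
  also have "\<dots> < A^3 * \<beta>^3 * (\<beta> - 1) * D powr (\<beta> * \<gamma>)"
    using K D by simp
  also have "D powr (\<beta> * \<gamma>) = D powr (\<beta> - 1) * D powr (\<beta> - 1) * D powr (\<beta> - 2)"
    unfolding powr_add[symmetric] \<beta>\<gamma>[symmetric] by (simp add: algebra_simps)
  finally show False by (simp add: algebra_simps power2_eq_square power3_eq_cube)
qed

text \<open>If the bound failed, a barrier centred at \<open>y\<close> could be given a radius
  larger than the distance to \<open>z\<close>; it would be positive at \<open>z\<close> and force
  \<open>u z > 0\<close>.\<close>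

lemma viscosity_supersol_growth:
  fixes y z :: "real ^ 'n::finite"
  assumes sup: "viscosity_supersol f \<Omega> u" and mono: "mono_on {0..} f"
    and nonneg: "\<And>x. x \<in> \<Omega> \<Longrightarrow> 0 \<le> u x" and sub: "ball x0 (3 * r) \<subseteq> \<Omega>"
    and "0 < A" "0 \<le> \<gamma>" "\<gamma> < 3" and \<beta>: "\<beta> = 4 / (3 - \<gamma>)"
    and f: "\<And>t. 0 < t \<Longrightarrow> t \<le> T \<Longrightarrow> f t \<le> K * t powr \<gamma>"
    and K: "K * A powr \<gamma> < A^3 * \<beta>^3 * (\<beta> - 1)"
    and "u y \<le> T" and y: "y \<in> ball x0 r" and z: "z \<in> ball x0 r" and "u z = 0"
  shows "u y \<le> A * norm (z - y) powr \<beta>"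
proof (rule ccontr)
  assume n: "\<not> ?thesis"
  have "\<beta> > 0" using \<open>\<gamma> < 3\<close> by (auto simp: \<beta> field_simps)
  have zy: "norm (z - y) < 2 * r"
    using y z
    by (smt (verit) dist_commute dist_norm dist_triangle mem_ball)
  \<comment> \<open>The second entry is the largest radius with
    \<open>A * R powr \<beta> \<le> u y\<close>. The first lies strictly between the distance of
    \<open>z\<close> and \<open>y\<close> and \<open>2 * r\<close>, which keeps
    \<open>cball y R\<close> inside \<open>ball x0 (3 * r)\<close>.\<close>
  define R where "R = min (norm (z - y) / 2 + r) ((u y / A) powr (1 / \<beta>))"
  have uy: "0 < u y" using n \<open>0 < A\<close> by (smt (verit) mult_nonneg_nonneg powr_ge_zero)
  have "norm (z - y) = (norm (z - y) powr \<beta>) powr (1 / \<beta>)"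
    using \<open>\<beta> > 0\<close> by (simp add: powr_powr)
  also have "\<dots> < (u y / A) powr (1 / \<beta>)"
    using n \<open>\<beta> > 0\<close> \<open>0 < A\<close> by (intro powr_less_mono2) (auto simp: field_simps)
  finally have zR: "norm (z - y) < R" using zy by (simp add: R_def)
  have "0 \<le> R" using zR norm_ge_zero[of "z - y"] by linarith
  moreover have "R \<le> (u y / A) powr (1 / \<beta>)" by (simp add: R_def)
  ultimately have "R powr \<beta> \<le> ((u y / A) powr (1 / \<beta>)) powr \<beta>"
    using \<open>\<beta> > 0\<close> by (intro powr_mono2) auto
  also have "\<dots> = u y / A" using \<open>\<beta> > 0\<close> uy \<open>0 < A\<close> by (simp add: powr_powr)
  finally have AR: "A * R powr \<beta> \<le> u y" using \<open>0 < A\<close> by (simp add: field_simps)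
  have "R < 2 * r" using zy by (simp add: R_def min_def)
  have "cball y R \<subseteq> \<Omega>"
  proof
    fix x assume "x \<in> cball y R"
    then have "dist x0 x < 3 * r"
      using y \<open>R < 2 * r\<close> dist_triangle[of x0 x y] by (simp add: dist_commute)
    then show "x \<in> \<Omega>" using sub by auto
  qed
  then have "A * (R - norm (z - y)) powr \<beta> \<le> u z"
    using viscosity_supersol_barrier[OF sup mono nonneg _ \<open>0 < A\<close> \<open>0 \<le> \<gamma>\<close> \<open>\<gamma> < 3\<close> \<beta> f K AR, of z] \<open>u y \<le> T\<close> zR
    by (auto simp: dist_norm norm_minus_commute)
  moreover have "0 < A * (R - norm (z - y)) powr \<beta>" using zR \<open>0 < A\<close> by simp
  ultimately show False using \<open>u z = 0\<close> by simp
qed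

text \<open>If \<open>u\<close> stayed below \<open>c * r powr \<beta>\<close>, then
  \<open>u\<close> minus the comparison function would have a positive maximum off the sphere. There
  the comparison function is a strict supersolution, a contradiction. The maximum may sit at
  \<open>x1\<close> itself, where the unshifted power need not be C2; the shift \<open>e\<close>
  removes this singularity.\<close>

lemma viscosity_subsol_nondegenerate:
  fixes x1 :: "real ^ 'n::finite"
  assumes sol: "viscosity_subsol f \<Omega> u" and mono: "mono_on {0..} f"
    and sub: "cball x1 r \<subseteq> \<Omega>" and "0 < r"
    and "0 < c" "0 \<le> \<gamma>" "\<gamma> < 3" and \<beta>: "\<beta> = 4 / (3 - \<gamma>)"
    and f: "\<And>t. 0 < t \<Longrightarrow> t \<le> T \<Longrightarrow> L * t powr \<gamma> \<le> f t"
    and c: "c^3 * \<beta>^4 < L * c powr \<gamma>"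
    and uT: "\<And>x. x \<in> cball x1 r \<Longrightarrow> u x \<le> T" and ux1: "0 < u x1"
  shows "\<exists>y\<in>cball x1 r. c * r powr \<beta> \<le> u y"
proof (rule ccontr)
  assume n: "\<not> ?thesis"
  have \<beta>1: "\<beta> > 1" and \<beta>\<gamma>: "3 * \<beta> - 4 = \<beta> * \<gamma>"
    using \<open>0 \<le> \<gamma>\<close> \<open>\<gamma> < 3\<close> by (auto simp: \<beta> field_simps)
  \<comment> \<open>With this \<open>e\<close> the comparison function equals
    \<open>u x1 / 2\<close> at the centre.\<close>
  define e where "e = (u x1 / (2 * c)) powr (2 / \<beta>)"
  have e: "0 < e" and ce: "c * e powr (\<beta> / 2) < u x1"
    using ux1 \<open>0 < c\<close> \<beta>1 by (auto simp: e_def powr_powr)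
  define g where "g = (\<lambda>s. c * (e + s) powr (\<beta> / 2))"
  define w where "w = (\<lambda>x. g ((norm (x - x1))\<^sup>2))"
  have "continuous_on (cball x1 r) w"
    unfolding w_def g_def using \<beta>1 e
    by (intro continuous_intros continuous_on_powr') (auto simp: add_pos_nonneg less_imp_le)
  moreover have "continuous_on (cball x1 r) u"
    using sol sub unfolding viscosity_subsol_def by (meson continuous_on_subset)
  moreover have x1: "x1 \<in> cball x1 r" using \<open>0 < r\<close> by simp
  ultimately obtain p where p: "p \<in> cball x1 r"
    and max: "\<And>x. x \<in> cball x1 r \<Longrightarrow> u x - w x \<le> u p - w p"
    using continuous_attains_sup[OF compact_cball _ continuous_on_diff, of x1 r u w]
    by blast
  have up: "w p < u p" using max[OF x1] ce by (simp add: w_def g_def)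
  have "norm (p - x1) \<noteq> r"
  proof
    assume "norm (p - x1) = r"
    have "c * r powr \<beta> = c * (r\<^sup>2) powr (\<beta> / 2)"
      using \<open>0 < r\<close> by (simp add: powr_powr flip: powr_numeral)
    also have "\<dots> \<le> w p"
      using \<open>norm (p - x1) = r\<close> \<open>0 < c\<close> e \<beta>1 by (auto simp: w_def g_def intro!: mult_left_mono powr_mono2)
    finally show False using n up p by force
  qed
  then have pr: "norm (p - x1) < r" using p by (simp add: dist_norm norm_minus_commute)
  define s where "s = (norm (p - x1))\<^sup>2"
  define \<sigma> where "\<sigma> = e + s"
  \<comment> \<open>Factoring out this power leaves only integer powers of \<sigma>; at the end
    \<open>P^3 * \<sigma>^4\<close> is again the power of \<sigma> that occurs in
    \<open>w p powr \<gamma>\<close>.\<close>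
  define P where "P = \<sigma> powr (\<beta> / 2 - 2)"
  have s: "0 \<le> s" "s \<le> \<sigma>" and \<sigma>: "0 < \<sigma>"
    using e by (auto simp: s_def \<sigma>_def intro: add_pos_nonneg)
  have P: "0 < P" using \<sigma> by (simp add: P_def)
  have wp: "w p = c * \<sigma> powr (\<beta> / 2)" by (simp add: w_def g_def \<sigma>_def s_def)
  have "L * w p powr \<gamma> \<le> f (w p)"
    using up uT[OF p] \<sigma> \<open>0 < c\<close> by (intro f) (auto simp: wp)
  also have "f (w p) \<le> f (u p)"
  proof (rule mono_onD[OF mono])
    have "0 \<le> w p" using \<open>0 < c\<close> by (simp add: wp)
    then show "w p \<in> {0..}" "u p \<in> {0..}" "w p \<le> u p" using up by auto
  qed
  also have "f (u p) \<le> 8 * s * (c * (\<beta> / 2) * (e + s) powr (\<beta> / 2 - 1))\<^sup>2 *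
      (2 * s * (c * (\<beta> / 2) * (\<beta> / 2 - 1) * (e + s) powr (\<beta> / 2 - 2)) + c * (\<beta> / 2) * (e + s) powr (\<beta> / 2 - 1))"
    unfolding s_def
  proof (rule viscosity_subsol_radial[OF sol, where g = g])
    show "p \<in> \<Omega>" using p sub by auto
    have "\<forall>\<^sub>F t in nhds ((norm (p - x1))\<^sup>2). 0 < e + t"
      using \<sigma> by (intro eventually_nhds_in_open[of "{t. 0 < e + t}", simplified] open_Collect_less continuous_intros)
        (auto simp: \<sigma>_def s_def)
    then show "\<forall>\<^sub>F t in nhds ((norm (p - x1))\<^sup>2). (g has_real_derivative
        c * (\<beta> / 2) * (e + t) powr (\<beta> / 2 - 1)) (at t)"
      unfolding g_def by eventually_elim (auto intro!: derivative_eq_intros)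
    show "((\<lambda>t. c * (\<beta> / 2) * (e + t) powr (\<beta> / 2 - 1)) has_real_derivative
        c * (\<beta> / 2) * (\<beta> / 2 - 1) * (e + (norm (p - x1))\<^sup>2) powr (\<beta> / 2 - 2)) (at ((norm (p - x1))\<^sup>2))"
      using \<sigma> by (auto intro!: derivative_eq_intros simp: \<sigma>_def s_def)
    have "\<forall>\<^sub>F x in at p within \<Omega>. x \<in> ball x1 r"
      using pr unfolding eventually_at_topological
      by (intro exI[of _ "ball x1 r"]) (auto simp: dist_norm norm_minus_commute)
    then show "\<forall>\<^sub>F x in at p within \<Omega>. u x - g ((norm (x - x1))\<^sup>2) \<le> u p - g ((norm (p - x1))\<^sup>2)"
      by eventually_elim (use max in \<open>auto simp: w_def\<close>)
  qed
  also have "\<dots> = c^3 * \<beta>^3 * P^3 * \<sigma>\<^sup>2 * (s * (s * (\<beta> - 2) + \<sigma>))"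
  proof -
    have P1: "(e + s) powr (\<beta> / 2 - 1) = P * \<sigma>"
      using \<sigma> powr_add[of \<sigma> "\<beta> / 2 - 2" 1] by (simp add: P_def flip: \<sigma>_def)
    show ?thesis unfolding P1 unfolding P_def[symmetric] \<sigma>_def[symmetric]
      by (simp add: field_simps power2_eq_square power3_eq_cube)
  qed
  also have "\<dots> \<le> c^3 * \<beta>^3 * P^3 * \<sigma>\<^sup>2 * (\<sigma> * (\<beta> * \<sigma>))"
  proof -
    \<comment> \<open>The detour through \<open>\<beta> - 1\<close> is taken because
      \<open>\<beta> - 2\<close> may be negative.\<close>
    have "s * (\<beta> - 2) \<le> s * (\<beta> - 1)" using s by (intro mult_left_mono) auto
    also have "\<dots> \<le> \<sigma> * (\<beta> - 1)" using s \<beta>1 by (intro mult_right_mono) auto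
    finally have "s * (\<beta> - 2) + \<sigma> \<le> \<beta> * \<sigma>" by (simp add: algebra_simps)
    then have "s * (s * (\<beta> - 2) + \<sigma>) \<le> s * (\<beta> * \<sigma>)" using s by (intro mult_left_mono) auto
    also have "\<dots> \<le> \<sigma> * (\<beta> * \<sigma>)" using s \<beta>1 \<sigma> by (intro mult_right_mono) auto
    finally show ?thesis using \<open>0 < c\<close> \<beta>1 P by (intro mult_left_mono) auto
  qed
  also have "\<dots> = c^3 * \<beta>^4 * (P^3 * \<sigma>^4)"
    by (simp add: power2_eq_square power3_eq_cube power4_eq_xxxx)
  also have "P^3 * \<sigma>^4 = \<sigma> powr (\<beta> / 2 * \<gamma>)"
  proof -
    have "P^3 * \<sigma>^4 = P powr 3 * \<sigma> powr 4"
      using \<sigma> P by simp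
    also have "\<dots> = \<sigma> powr ((\<beta> / 2 - 2) * 3 + 4)"
      unfolding powr_add P_def powr_powr ..
    also have "(\<beta> / 2 - 2) * 3 + 4 = \<beta> / 2 * \<gamma>" using \<beta>\<gamma> by (simp add: algebra_simps)
    finally show ?thesis .
  qed
  also have "c^3 * \<beta>^4 * \<sigma> powr (\<beta> / 2 * \<gamma>) < L * c powr \<gamma> * \<sigma> powr (\<beta> / 2 * \<gamma>)"
    using c \<sigma> by simp
  also have "\<dots> = L * w p powr \<gamma>"
    using \<open>0 < c\<close> by (simp add: wp powr_mult powr_powr)
  finally show False by simp
qed

text \<open>For large \<open>x\<close> the cube wins because \<gamma> < 3; the witness has
  \<open>x powr (3 - \<gamma>) = a / b + 1\<close>. It supplies the growth constant
  \<open>A\<close>.\<close>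

lemma ex_powr_mult_less_cube:
  fixes a b \<gamma> :: real
  assumes "\<gamma> < 3" "0 < b" "0 \<le> a"
  obtains x where "0 < x" "a * x powr \<gamma> < x^3 * b"
proof
  define x where "x = (a / b + 1) powr (1 / (3 - \<gamma>))"
  have "0 < a / b + 1" using assms by (simp add: add_nonneg_pos)
  then show x: "0 < x" unfolding x_def by simp
  have "a < x powr (3 - \<gamma>) * b"
    using assms \<open>0 < a / b + 1\<close> by (simp add: x_def powr_powr field_simps)
  then have "a * x powr \<gamma> < x powr (3 - \<gamma>) * b * x powr \<gamma>" using x by simp
  also have "\<dots> = x powr 3 * b" by (simp add: mult_ac flip: powr_add mult.assoc)
  finally show "a * x powr \<gamma> < x^3 * b" using x by simp
qed

text \<open>For small \<open>x\<close> the lower power wins; the witness has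
  \<open>x powr (3 - \<gamma>) = a / (2 * b)\<close>. It supplies the non-degeneracy constant
  \<open>c\<close>.\<close>

lemma ex_cube_mult_less_powr:
  fixes a b \<gamma> :: real
  assumes "\<gamma> < 3" "0 < b" "0 < a"
  obtains x where "0 < x" "x^3 * b < a * x powr \<gamma>"
proof
  define x where "x = (a / (2 * b)) powr (1 / (3 - \<gamma>))"
  have "0 < a / (2 * b)" using assms by simp
  then show x: "0 < x" using assms by (simp add: x_def)
  have "x powr (3 - \<gamma>) * b < a"
    using assms \<open>0 < a / (2 * b)\<close> by (simp add: x_def powr_powr)
  then have "x powr (3 - \<gamma>) * b * x powr \<gamma> < a * x powr \<gamma>" using x by simp
  moreover have "x powr (3 - \<gamma>) * b * x powr \<gamma> = x powr 3 * b" by (simp add: mult_ac flip: powr_add mult.assoc)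
  ultimately show "x^3 * b < a * x powr \<gamma>" using x by simp
qed

section \<open>Porosity, or emptiness, of the free boundary\<close>

theorem corollary5p2:
  fixes \<Omega> :: "(real ^ 'n::finite) set"
    and f :: "real \<Rightarrow> real"
    and u :: "real ^ 'n \<Rightarrow> real"
    and M N \<gamma> :: real
  assumes "open \<Omega>"
    and "continuous_on {0..} f"
    and "mono_on {0..} f"
    and "M > 0" and "N > 0"
    and "0 \<le> \<gamma>" and "\<gamma> < 3"
    and "\<forall>T>0. \<exists>\<delta>0>0. \<forall>t \<delta>. 0 < t \<and> t \<le> T \<and> 0 < \<delta> \<and> \<delta> < \<delta>0 \<longrightarrow>
           0 \<le> f (\<delta> * t) \<and> f (\<delta> * t) \<le> M * \<delta> powr \<gamma> * f t \<and>
           f (\<delta> * t) \<ge> N * \<delta> powr \<gamma> * f t \<and> N * \<delta> powr \<gamma> * f t \<ge> 0"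
    and "\<forall>x\<in>\<Omega>. u x \<ge> 0"
    and "viscosity_sol f \<Omega> u"
  shows "frontier {x \<in> \<Omega>. u x > 0} \<inter> \<Omega> \<in> null_sets lebesgue"
proof -
  define F where "F = frontier {x \<in> \<Omega>. u x > 0} \<inter> \<Omega>"
  define \<beta> where "\<beta> = 4 / (3 - \<gamma>)"
  have \<beta>1: "1 < \<beta>" using \<open>0 \<le> \<gamma>\<close> \<open>\<gamma> < 3\<close> by (simp add: \<beta>_def field_simps)
  have sup: "viscosity_supersol f \<Omega> u" and sub: "viscosity_subsol f \<Omega> u"
    using assms by (auto simp: viscosity_sol_def)
  then have contu: "continuous_on \<Omega> u" by (simp add: viscosity_subsol_def)
  have nonneg: "\<And>x. x \<in> \<Omega> \<Longrightarrow> 0 \<le> u x" using assms by simp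
  \<comment> \<open>Taking \<open>t = 1\<close> in the scaling hypothesis compares
    \<open>f \<delta>\<close> with a multiple of \<open>\<delta> powr \<gamma>\<close>.\<close>
  obtain \<delta>0 where \<delta>0: "0 < \<delta>0" and growth: "\<And>\<delta>. 0 < \<delta> \<Longrightarrow> \<delta> < \<delta>0 \<Longrightarrow>
      f \<delta> \<le> M * \<delta> powr \<gamma> * f 1 \<and> N * \<delta> powr \<gamma> * f 1 \<le> f \<delta> \<and> 0 \<le> N * \<delta> powr \<gamma> * f 1"
    using assms(8)[rule_format, of 1] by (metis mult.right_neutral order_refl zero_less_one)
  define T where "T = \<delta>0 / 2"
  have T: "0 < T" using \<delta>0 by (simp add: T_def)
  have fle: "f t \<le> (M * f 1) * t powr \<gamma>" and fge: "(N * f 1) * t powr \<gamma> \<le> f t" if "0 < t" "t \<le> T" for t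
    using growth[of t] that \<delta>0 by (auto simp: T_def mult_ac)
  have f1: "0 \<le> f 1"
  proof -
    have "0 < N * T powr \<gamma>" using \<open>N > 0\<close> T by simp
    moreover have "0 \<le> N * T powr \<gamma> * f 1" using growth[of T] \<delta>0 T by (simp add: T_def)
    ultimately show ?thesis by (simp only: zero_le_mult_iff) linarith
  qed
  have F0: "u x = 0" if "x \<in> F" for x
  proof (rule ccontr)
    assume "u x \<noteq> 0"
    then have "x \<in> {x \<in> \<Omega>. u x > 0}" using that nonneg[of x] by (auto simp: F_def)
    moreover have "open {x \<in> \<Omega>. u x > 0}"
      using continuous_open_preimage[OF contu \<open>open \<Omega>\<close>, of "{0<..}"] by (simp add: vimage_def Int_def)
    ultimately show False using that by (auto simp: F_def frontier_def interior_open)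
  qed
  have near: "\<exists>\<rho>>0. ball x \<rho> \<subseteq> \<Omega> \<and> (\<forall>y\<in>ball x \<rho>. u y \<le> T)" if "x \<in> F" for x
  proof -
    have "open (\<Omega> \<inter> u -` {..<T})"
      by (rule continuous_open_preimage[OF contu \<open>open \<Omega>\<close>]) simp
    moreover have "x \<in> \<Omega> \<inter> u -` {..<T}" using F0[OF that] that T by (auto simp: F_def)
    ultimately obtain \<rho> where "\<rho> > 0" "ball x \<rho> \<subseteq> \<Omega> \<inter> u -` {..<T}"
      by (meson openE)
    then show ?thesis by (intro exI[of _ \<rho>]) force
  qed
  have positive: "\<exists>y\<in>ball x e. y \<in> \<Omega> \<and> 0 < u y" if "x \<in> F" "0 < e" for x e
    using that by (force simp: F_def frontier_def closure_approachable dist_commute)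
  have "negligible F"
  proof (cases "f 1 = 0")
    case True
    have "F = {}"
    proof (rule ccontr)
      assume "F \<noteq> {}"
      then obtain x where x: "x \<in> F" by auto
      obtain \<rho> where \<rho>: "\<rho> > 0" "ball x \<rho> \<subseteq> \<Omega>" "\<forall>y\<in>ball x \<rho>. u y \<le> T"
        using near[OF x] by auto
      obtain y where y: "y \<in> ball x (\<rho> / 3)" "0 < u y" using positive[OF x, of "\<rho> / 3"] \<rho> by auto
      \<comment> \<open>Since \<open>f 1 = 0\<close>, the condition on \<open>A\<close> has left
        side 0 and holds for every positive \<open>A\<close>. Letting \<open>A\<close> tend to 0
        contradicts \<open>0 < u y\<close>.\<close>
      have "u y \<le> 0 + norm (x - y) powr \<beta> * A" if "0 < A" for A
      proof -
        have "u y \<le> A * norm (x - y) powr \<beta>"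
        proof (rule viscosity_supersol_growth[OF sup assms(3) nonneg _ that \<open>0 \<le> \<gamma>\<close> \<open>\<gamma> < 3\<close> \<beta>_def fle])
          show "ball x (3 * (\<rho> / 3)) \<subseteq> \<Omega>" using \<rho> by simp
          show "M * f 1 * A powr \<gamma> < A ^ 3 * \<beta> ^ 3 * (\<beta> - 1)" using True that \<beta>1 by simp
          have "ball x (\<rho> / 3) \<subseteq> ball x \<rho>" using \<rho> by (intro subset_ball) simp
          then show "u y \<le> T" using y \<rho> by blast
        qed (use y \<rho> F0[OF x] in simp_all)
        then show ?thesis by (simp add: mult.commute)
      qed
      then have "u y \<le> 0" by (rule le_affine_imp_le[OF powr_ge_zero])
      with y show False by simp
    qed
    then show ?thesis by simp
  next
    case False
    then have "0 < f 1" using f1 by simp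
    obtain A where A: "0 < A" "(M * f 1) * A powr \<gamma> < A^3 * (\<beta>^3 * (\<beta> - 1))"
      using \<beta>1 \<open>M > 0\<close> \<open>0 < f 1\<close> ex_powr_mult_less_cube[OF \<open>\<gamma> < 3\<close>, of "\<beta>^3 * (\<beta> - 1)" "M * f 1"] by auto
    obtain c where c: "0 < c" "c^3 * \<beta>^4 < (N * f 1) * c powr \<gamma>"
      using \<beta>1 \<open>N > 0\<close> \<open>0 < f 1\<close> ex_cube_mult_less_powr[OF \<open>\<gamma> < 3\<close>, of "\<beta>^4" "N * f 1"] by auto
    \<comment> \<open>The second entry makes \<open>A * (\<kappa> * r) powr \<beta>\<close> smaller
      than the value \<open>c * (r / 4) powr \<beta>\<close> reached near the free boundary. The
      bound 1/2 keeps the hole inside \<open>ball x r\<close>, its centre being within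
      \<open>r / 2\<close> of \<open>x\<close>.\<close>
    define \<kappa> where "\<kappa> = min (1/2) ((c / (2 * A)) powr (1 / \<beta>) * (1 / 4))"
    have \<kappa>: "0 < \<kappa>" "\<kappa> \<le> 1/2" using A c by (auto simp: \<kappa>_def)
    have "A * \<kappa> powr \<beta> \<le> A * ((c / (2 * A)) powr (1 / \<beta>) * (1 / 4)) powr \<beta>"
      using A \<kappa> \<beta>1 by (intro mult_left_mono powr_mono2) (auto simp: \<kappa>_def)
    also have "\<dots> = c / 2 * (1 / 4) powr \<beta>"
      using A c \<beta>1 by (subst powr_mult) (auto simp: powr_powr)
    also have "\<dots> < c * (1 / 4) powr \<beta>" using c by simp
    finally have A\<kappa>: "A * \<kappa> powr \<beta> < c * (1 / 4) powr \<beta>" .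
    show ?thesis
    proof (rule porous_imp_negligible)
      show "F \<in> sets lebesgue" unfolding F_def using \<open>open \<Omega>\<close> by (intro sets.Int) auto
      show "0 < \<kappa>" by fact
      fix x and e :: real assume x: "x \<in> F" and "0 < e"
      obtain \<rho> where \<rho>: "\<rho> > 0" "ball x \<rho> \<subseteq> \<Omega>" "\<forall>y\<in>ball x \<rho>. u y \<le> T"
        using near[OF x] by auto
      define r where "r = min (e / 2) (\<rho> / 3)"
      have r: "0 < r" "r < e" "3 * r \<le> \<rho>" using \<open>0 < e\<close> \<rho> by (auto simp: r_def)
      \<comment> \<open>Non-degeneracy needs a point of positivity, and \<open>u\<close> vanishes at
        \<open>x\<close>; so it is applied at a nearby \<open>x1\<close>.\<close>
      obtain x1 where x1: "dist x x1 < r / 4" "0 < u x1" using positive[OF x, of "r / 4"] r by auto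
      have x1r: "cball x1 (r / 4) \<subseteq> ball x (r / 2)"
      proof
        fix z assume "z \<in> cball x1 (r / 4)"
        then show "z \<in> ball x (r / 2)" using x1 dist_triangle[of x z x1] by simp
      qed
      also have "\<dots> \<subseteq> ball x \<rho>" using r by (intro subset_ball) simp
      finally have x1\<rho>: "cball x1 (r / 4) \<subseteq> ball x \<rho>" .
      obtain y where y: "y \<in> cball x1 (r / 4)" "c * (r / 4) powr \<beta> \<le> u y"
        using viscosity_subsol_nondegenerate[OF sub assms(3) _ _ \<open>0 < c\<close> \<open>0 \<le> \<gamma>\<close> \<open>\<gamma> < 3\<close> \<beta>_def fge c(2), of x1 "r / 4"]
          x1\<rho> \<rho> r x1 by force
      have yr: "y \<in> ball x (r / 2)" using y x1r by auto
      have "\<kappa> * r \<le> r / 2" using \<kappa> r by (simp add: mult_right_mono[of \<kappa> "1/2" r, simplified])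
      have in_ball: "ball y (\<kappa> * r) \<subseteq> ball x r"
      proof
        fix z assume "z \<in> ball y (\<kappa> * r)"
        then show "z \<in> ball x r"
          using yr \<open>\<kappa> * r \<le> r / 2\<close> dist_triangle[of x z y] by auto
      qed
      \<comment> \<open>A free boundary point is a zero of \<open>u\<close>; one this close to
        \<open>y\<close> would make \<open>u y\<close> too small by the growth bound.\<close>
      have "z \<notin> F" if z: "z \<in> ball y (\<kappa> * r)" for z
      proof
        assume "z \<in> F"
        have "u y \<le> A * norm (z - y) powr \<beta>"
        proof (rule viscosity_supersol_growth[OF sup assms(3) nonneg _ \<open>0 < A\<close> \<open>0 \<le> \<gamma>\<close> \<open>\<gamma> < 3\<close> \<beta>_def fle])
          show "ball x (3 * r) \<subseteq> \<Omega>" using \<rho> r subset_ball by blast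
          show "M * f 1 * A powr \<gamma> < A ^ 3 * \<beta> ^ 3 * (\<beta> - 1)" using A by (simp add: mult_ac)
          show "u y \<le> T" using y x1\<rho> \<rho> by auto
          show "y \<in> ball x r" using yr r by auto
          show "z \<in> ball x r" using z in_ball by auto
          show "u z = 0" using F0 \<open>z \<in> F\<close> .
        qed
        also have "\<dots> \<le> A * (\<kappa> * r) powr \<beta>"
          using z A \<beta>1 by (intro mult_left_mono powr_mono2) (auto simp: dist_norm norm_minus_commute)
        also have "\<dots> = A * \<kappa> powr \<beta> * r powr \<beta>" using \<kappa> r by (simp add: powr_mult)
        also have "\<dots> < c * (1 / 4) powr \<beta> * r powr \<beta>" using A\<kappa> r by simp
        also have "\<dots> = c * (r / 4) powr \<beta>" using r powr_mult[of "1/4" r \<beta>] by simp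
        finally show False using y by simp
      qed
      with in_ball r show "\<exists>r y. 0 < r \<and> r < e \<and> ball y (\<kappa> * r) \<subseteq> ball x r \<and> ball y (\<kappa> * r) \<inter> F = {}"
        by blast
    qed
  qed
  then show ?thesis by (simp add: F_def negligible_iff_null_sets)
qed

end
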